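(* Let $s=(s(i_D),\,D\in\mathcal D,\,i_D\in\mathcal I_D^* )\in\mathbb R^{d_{\mathcal D}}$ and $\alpha\in\mathbb R$. The prior distribution $\pi_{\mathcal D}(\theta_{\mathcal D}\mid s,\alpha)$ is proper, i.e. $I_{\mathcal D}(s,\alpha)<+\infty$, if and only if $\alpha>0$ and there exists an array of real numbers $\rho(j)>0$, $j\in\mathcal I$, such that $$s(i_D)=\alpha\sum_{j\in\mathcal I:\ j_D=i_D}\rho(j),\qquad D\in\mathcal D,\ i_D\in\mathcal I_D^*,$$ where, for some $\theta_{\mathcal D}=(\theta(i_D),\,D\in\mathcal D,\,i_D\in\mathcal I_D^* )\in\mathbb R^{d_{\mathcal D}}$, $$\rho(i(E))=\frac{\exp\sum_{F\in\mathcal D,\,F\subseteq E}\theta(i_F)}{1+\sum_{H\subseteq V,\,H\neq\varnothing}\ \sum_{j_H\in\mathcal I_H^*}\exp\Big(\sum_{F\in\mathcal D,\,F\subseteq H}\theta(j_F)\Big)}\qquad\text{for all }E\subseteq V,\ i_E\in\mathcal I_E^*.$$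
   Context: $V$ is a finite nonempty set; for each $\gamma\in V$, $\mathcal I_\gamma$ is a finite set of levels with at least two elements, one of which is denoted $0$. The set of cells is $\mathcal I=\prod_{\gamma\in V}\mathcal I_\gamma$, and $i^*=(0,\dots,0)$. For $E\subseteq V$, $\mathcal I_E=\prod_{\gamma\in E}\mathcal I_\gamma$, $i_E$ denotes an element of $\mathcal I_E$ (for $i\in\mathcal I$, or for $i\in\mathcal I_H$ with $H\supseteq E$, $i_E$ is the subvector indexed by $E$), and $\mathcal I_E^*=\{i_E\in\mathcal I_E:\ i_\gamma\neq 0\ \forall\gamma\in E\}$ (for $E=\varnothing$ it has exactly one element, the empty vector). For $i_E\in\mathcal I_E^*$, $i(E)=(i_E,i^*_{E^c})\in\mathcal I$ is the cell agreeing with $i_E$ on $E$ and equal to $0$ off $E$; every cell of $\mathcal I$ is $i(E)$ for exactly one $E\subseteq V$ and $i_E\in\mathcal I_E^*$. A hierarchical log-linear model is given by a generating class $\{A_1,\dots,A_k\}$ of subsets of $V$, and $\mathcal D=\{E\neq\varnothing:\ E\subseteq A_l\text{ for some }l\}$. Put $d_{\mathcal D}=\sum_{D\in\mathcal D}|\mathcal I_D^*|$. For $\theta_{\mathcal D}=(\theta(i_D),D\in\mathcal D,i_D\in\mathcal I_D^* )\in\mathbb R^{d_{\mathcal D}}$, the prior $\pi_{\mathcal D}$ has density with respect to Lebesgue measure on $\mathbb R^{d_{\mathcal D}}$ $$\pi_{\mathcal D}(\theta_{\mathcal D}\mid s,\alpha)=I_{\mathcal D}(s,\alpha)^{-1}\exp\Big\{\sum_{D\in\mathcal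 D}\sum_{i_D\in\mathcal I_D^*}\theta(i_D)s(i_D)-\alpha\log\Big(1+\sum_{E\subseteq V,\,E\ne\varnothing}\ \sum_{i_E\in\mathcal I_E^*}\exp\sum_{F\in\mathcal D,\,F\subseteq E}\theta(i_F)\Big)\Big\},$$ where $I_{\mathcal D}(s,\alpha)\in(0,+\infty]$ is the integral over $\mathbb R^{d_{\mathcal D}}$ of the exponential factor. Empty sums are $0$.
   Formalization: The formal statement assumes that 𝒟 is nonempty: if 𝒟 is empty, then d_𝒟 = 0 and I_𝒟(s,α) = |𝓘|^{-α} is finite for every real α, so the stated equivalence fails for α ≤ 0. *)

theory Defs
  imports "HOL-Analysis.Analysis"
begin

text \<open>
  The level sets are a family \<open>L :: 'v \<Rightarrow> 'l set\<close> inside one ambient type, and \<open>z \<gamma>\<close> is the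
  level of the factor \<open>\<gamma>\<close> that is written 0 in the mathematics. A marginal cell over \<open>E\<close> is an
  extensional function in \<open>PiE E L\<close>; its subvector over \<open>F \<subseteq> E\<close> is \<open>restrict x F\<close>.
\<close>

definition cells :: "('v \<Rightarrow> 'l set) \<Rightarrow> 'v set \<Rightarrow> ('v \<Rightarrow> 'l) set" where
  "cells L E = PiE E L"

definition nonzero_cells :: "('v \<Rightarrow> 'l set) \<Rightarrow> ('v \<Rightarrow> 'l) \<Rightarrow> 'v set \<Rightarrow> ('v \<Rightarrow> 'l) set" where
  "nonzero_cells L z E = {x \<in> cells L E. \<forall>\<gamma>\<in>E. x \<gamma> \<noteq> z \<gamma>}"

text \<open>The cell \<open>i(E) = (i\<^sub>E, i\<^sup>*\<^sub>E\<^sub>c)\<close>.\<close>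

definition extend_cell :: "'v set \<Rightarrow> ('v \<Rightarrow> 'l) \<Rightarrow> 'v set \<Rightarrow> ('v \<Rightarrow> 'l) \<Rightarrow> ('v \<Rightarrow> 'l)" where
  "extend_cell V z E x = (\<lambda>\<gamma>\<in>V. if \<gamma> \<in> E then x \<gamma> else z \<gamma>)"

definition model_sets :: "'v set set \<Rightarrow> 'v set set" where
  "model_sets \<A> = {E. E \<noteq> {} \<and> (\<exists>A\<in>\<A>. E \<subseteq> A)}"

text \<open>
  The coordinate \<open>\<theta>(i\<^sub>D)\<close> is \<open>\<theta> (D, x)\<close> with \<open>x\<close> the marginal cell \<open>i\<^sub>D\<close>. The parameter space of
  dimension \<open>d\<close> is the space of real functions on the finite set \<open>param_index\<close>, which has
  \<open>d\<close> elements.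
\<close>

type_synonym ('v, 'l) param = "'v set \<times> ('v \<Rightarrow> 'l) \<Rightarrow> real"

definition param_index ::
    "('v \<Rightarrow> 'l set) \<Rightarrow> ('v \<Rightarrow> 'l) \<Rightarrow> 'v set set \<Rightarrow> ('v set \<times> ('v \<Rightarrow> 'l)) set" where
  "param_index L z \<D> = Sigma \<D> (nonzero_cells L z)"

definition theta_sum :: "'v set set \<Rightarrow> ('v, 'l) param \<Rightarrow> 'v set \<Rightarrow> ('v \<Rightarrow> 'l) \<Rightarrow> real" where
  "theta_sum \<D> \<theta> E x = (\<Sum>F | F \<in> \<D> \<and> F \<subseteq> E. \<theta> (F, restrict x F))"

definition partition_sum ::
    "'v set \<Rightarrow> ('v \<Rightarrow> 'l set) \<Rightarrow> ('v \<Rightarrow> 'l) \<Rightarrow> 'v set set \<Rightarrow> ('v, 'l) param \<Rightarrow> real" where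
  "partition_sum V L z \<D> \<theta> =
     1 + (\<Sum>E | E \<subseteq> V \<and> E \<noteq> {}. \<Sum>x\<in>nonzero_cells L z E. exp (theta_sum \<D> \<theta> E x))"

definition prior_kernel ::
    "'v set \<Rightarrow> ('v \<Rightarrow> 'l set) \<Rightarrow> ('v \<Rightarrow> 'l) \<Rightarrow> 'v set set \<Rightarrow> ('v, 'l) param \<Rightarrow> real
      \<Rightarrow> ('v, 'l) param \<Rightarrow> real" where
  "prior_kernel V L z \<D> s \<alpha> \<theta> =
     exp ((\<Sum>D\<in>\<D>. \<Sum>x\<in>nonzero_cells L z D. \<theta> (D, x) * s (D, x))
          - \<alpha> * ln (partition_sum V L z \<D> \<theta>))"

definition param_lebesgue ::
    "('v \<Rightarrow> 'l set) \<Rightarrow> ('v \<Rightarrow> 'l) \<Rightarrow> 'v set set \<Rightarrow> ('v, 'l) param measure" where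
  "param_lebesgue L z \<D> = Pi\<^sub>M (param_index L z \<D>) (\<lambda>_. lborel)"

definition prior_const ::
    "'v set \<Rightarrow> ('v \<Rightarrow> 'l set) \<Rightarrow> ('v \<Rightarrow> 'l) \<Rightarrow> 'v set set \<Rightarrow> ('v, 'l) param \<Rightarrow> real \<Rightarrow> ennreal" where
  "prior_const V L z \<D> s \<alpha> =
     (\<integral>\<^sup>+ \<theta>. ennreal (prior_kernel V L z \<D> s \<alpha> \<theta>) \<partial>param_lebesgue L z \<D>)"

end

theory Submission imports Defs begin

text \<open>
  In cell coordinates the model is an exponential family on the finite set of cells: each cell
  \<open>j\<close> has a 0/1 vector \<open>f\<^sub>j\<close> that marks the coordinates \<open>(D, j\<^sub>D)\<close>, the sum
  \<open>\<Sum>\<^sub>F \<theta>(i\<^sub>F)\<close> at the cell \<open>i(E)\<close> is the inner product \<open>\<langle>f\<^sub>j, \<theta>\<rangle>\<close> with \<open>j = i(E)\<close>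
  (\<open>theta_sum_eq_pairing\<close>), and the partition sum is \<open>Z(\<theta>) = \<Sum>\<^sub>j exp \<langle>f\<^sub>j, \<theta>\<rangle>\<close>. The
  prior is the conjugate prior of this family, and the claim says that it is proper exactly when
  \<open>\<alpha> > 0\<close> and \<open>s / \<alpha>\<close> is the mean of the statistic \<open>f\<close> under some member of the family.

  Both conditions are equivalent, for \<open>\<alpha> > 0\<close>, to a third one, \<open>strictly_inside\<close>: no
  nonzero direction \<open>u\<close> satisfies \<open>\<alpha> \<langle>f\<^sub>j, u\<rangle> \<le> \<langle>s, u\<rangle>\<close> for all \<open>j\<close>. Geometrically,
  \<open>s / \<alpha>\<close> is an interior point of the convex hull of the vectors \<open>f\<^sub>j\<close>.

  \<^item> If it holds, compactness of the unit sphere and homogeneity make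
    \<open>\<alpha> ln Z(\<theta>) - \<langle>s, \<theta>\<rangle>\<close> grow at least linearly in the norm of \<open>\<theta>\<close>
    (\<open>potential_coercive\<close>). Hence the density decays exponentially and is integrable, and the
    function attains its minimum, where the vanishing gradient says that \<open>s\<close> is \<open>\<alpha>\<close>
    times a mean.

  \<^item> If \<open>u\<close> violates it, translating \<open>\<theta>\<close> along \<open>u\<close> does not decrease the unnormalised
    density, so the density is bounded below on infinitely many disjoint unit cubes and the
    integral diverges. For \<open>\<alpha> \<le> 0\<close> the density dominates the exponential of a linear
    function, and the same argument applies.

  \<^item> If \<open>s\<close> is \<open>\<alpha>\<close> times a mean and \<open>u\<close> violates it, then a weighted average of the
    nonnegative gaps \<open>\<langle>s, u\<rangle> - \<alpha> \<langle>f\<^sub>j, u\<rangle>\<close> is zero. So \<open>\<langle>f\<^sub>j, u\<rangle>\<close> is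
    constant in \<open>j\<close>, and \<open>u = 0\<close> by identifiability of the parametrisation
    (\<open>statistics_identifiable\<close>).
\<close>

section \<open>Linear functionals and cubes in a finite coordinate space\<close>

definition pairing :: "'k set \<Rightarrow> ('k \<Rightarrow> real) \<Rightarrow> ('k \<Rightarrow> real) \<Rightarrow> real" where
  "pairing J a \<theta> = (\<Sum>k\<in>J. \<theta> k * a k)"

definition l1_norm :: "'k set \<Rightarrow> ('k \<Rightarrow> real) \<Rightarrow> real" where
  "l1_norm J \<theta> = (\<Sum>k\<in>J. \<bar>\<theta> k\<bar>)"

lemma pairing_cong:
  "(\<And>k. k \<in> J \<Longrightarrow> a k = a' k) \<Longrightarrow> (\<And>k. k \<in> J \<Longrightarrow> \<theta> k = \<theta>' k) \<Longrightarrow> pairing J a \<theta> = pairing J a' \<theta>'"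
  by (simp add: pairing_def)

lemma pairing_scale: "pairing J a (\<lambda>k. c * \<theta> k) = c * pairing J a \<theta>"
  by (simp add: pairing_def sum_distrib_left mult.assoc)

lemma pairing_add: "pairing J a (\<lambda>k. \<theta> k + \<eta> k) = pairing J a \<theta> + pairing J a \<eta>"
  by (simp add: pairing_def sum.distrib algebra_simps)

lemma pairing_fun_upd:
  assumes "finite J" "k \<in> J"
  shows "pairing J a (\<theta>(k := \<theta> k + h)) = pairing J a \<theta> + h * a k"
proof -
  have "pairing J a (\<theta>(k := \<theta> k + h)) = (\<Sum>i\<in>J. \<theta> i * a i + (if i = k then h * a k else 0))"
    unfolding pairing_def by (intro sum.cong) (auto simp: algebra_simps)
  then show ?thesis
    using assms by (simp add: pairing_def sum.distrib)
qed

lemma abs_pairing_le_on_unit_cube: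
  assumes "\<And>k. k \<in> J \<Longrightarrow> \<bar>\<theta> k\<bar> \<le> 1"
  shows "\<bar>pairing J a \<theta>\<bar> \<le> (\<Sum>k\<in>J. \<bar>a k\<bar>)"
proof -
  have "\<bar>pairing J a \<theta>\<bar> \<le> (\<Sum>k\<in>J. \<bar>\<theta> k * a k\<bar>)"
    unfolding pairing_def by (rule sum_abs)
  also have "\<dots> \<le> (\<Sum>k\<in>J. \<bar>a k\<bar>)"
    using assms by (intro sum_mono) (auto simp: abs_mult intro: mult_left_le_one_le)
  finally show ?thesis .
qed

lemma continuous_on_pairing: "continuous_on S (\<lambda>\<theta>. pairing J a \<theta>)"
  unfolding pairing_def
  by (intro continuous_intros continuous_on_product_then_coordinatewise continuous_on_id)

lemma continuous_on_l1_norm: "continuous_on S (\<lambda>\<theta>. l1_norm J \<theta>)"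
  unfolding l1_norm_def
  by (intro continuous_intros continuous_on_product_then_coordinatewise continuous_on_id)

text \<open>
  Setting the coordinates outside \<open>J\<close> to 0 makes this a compact copy of \<open>[-R, R]\<^sup>J\<close> inside the
  full function type, whose topology is the product topology.
\<close>

definition cube :: "'k set \<Rightarrow> real \<Rightarrow> ('k \<Rightarrow> real) set" where
  "cube J R = {\<theta>. (\<forall>k\<in>J. \<bar>\<theta> k\<bar> \<le> R) \<and> (\<forall>k. k \<notin> J \<longrightarrow> \<theta> k = 0)}"

lemma compact_cube: "compact (cube J R)"
proof -
  have eq: "cube J R = PiE UNIV (\<lambda>k. if k \<in> J then {-R..R} else {0})"
    unfolding cube_def PiE_UNIV_domain Pi_def
    by (auto split: if_splits simp: abs_le_iff minus_le_iff)
  have "compactin (product_topology (\<lambda>k. euclidean) UNIV) (cube J R)"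
    unfolding eq compactin_PiE by auto
  then show ?thesis
    by (simp add: euclidean_product_topology)
qed

lemma cube_projection:
  assumes "\<And>k. k \<in> J \<Longrightarrow> \<bar>\<theta> k\<bar> \<le> R"
  shows "(\<lambda>k. if k \<in> J then \<theta> k else 0) \<in> cube J R"
  using assms by (auto simp: cube_def)

lemma coordinate_le_l1_norm: "finite J \<Longrightarrow> k \<in> J \<Longrightarrow> \<bar>\<theta> k\<bar> \<le> l1_norm J \<theta>"
  unfolding l1_norm_def by (rule member_le_sum) auto

section \<open>Convergence and divergence of integrals over a finite product of lines\<close>

lemma nn_integral_exp_minus_abs_finite:
  assumes "c > 0"
  shows "(\<integral>\<^sup>+ x. ennreal (exp (- c * \<bar>x\<bar>)) \<partial>lborel) < \<infinity>"
proof -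
  define I where "I = (\<integral>\<^sup>+ x. ennreal (exp (- c * x)) * indicator {0..} x \<partial>lborel)"
  have lim: "((\<lambda>x. - exp (- c * x) / c) \<longlongrightarrow> 0) at_top"
    using assms by real_asymp
  have "I = ennreal (0 - (- exp (- c * 0) / c))"
    unfolding I_def
    by (rule nn_integral_FTC_atLeast[OF _ _ _ lim]) 
       (use assms in \<open>auto intro!: derivative_eq_intros\<close>)
  then have I: "I < \<infinity>" by simp
  have reflected: "I = (\<integral>\<^sup>+ x. ennreal (exp (c * x)) * indicator {..0} x \<partial>lborel)"
    unfolding I_def
    by (subst nn_integral_real_affine[where c = "-1" and t = 0])
       (auto intro!: nn_integral_cong split: split_indicator)
  have "(\<integral>\<^sup>+ x. ennreal (exp (- c * \<bar>x\<bar>)) \<partial>lborel) \<le>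
     (\<integral>\<^sup>+ x. ennreal (exp (- c * x)) * indicator {0..} x + ennreal (exp (c * x)) * indicator {..0} x \<partial>lborel)"
    by (intro nn_integral_mono) (auto split: split_indicator)
  also have "\<dots> = I + I"
    using reflected by (subst nn_integral_add) (simp_all add: I_def)
  finally show ?thesis using I by (auto simp: order_le_less_trans)
qed

lemma nn_integral_exp_minus_l1_norm_finite:
  assumes "finite J" "c > 0"
  shows "(\<integral>\<^sup>+ \<theta>. ennreal (exp (- c * l1_norm J \<theta>)) \<partial>Pi\<^sub>M J (\<lambda>_. lborel)) < \<infinity>"
proof -
  interpret product_sigma_finite "\<lambda>_::'a. lborel :: real measure"
    by unfold_locales
  have "(\<integral>\<^sup>+ \<theta>. ennreal (exp (- c * l1_norm J \<theta>)) \<partial>Pi\<^sub>M J (\<lambda>_. lborel))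
      = (\<integral>\<^sup>+ \<theta>. (\<Prod>k\<in>J. ennreal (exp (- c * \<bar>\<theta> k\<bar>))) \<partial>Pi\<^sub>M J (\<lambda>_. lborel))"
    using assms(1)
    by (simp add: prod_ennreal l1_norm_def sum_distrib_left exp_sum[symmetric] flip: sum_negf)
  also have "\<dots> = (\<Prod>k\<in>J. \<integral>\<^sup>+ x. ennreal (exp (- c * \<bar>x\<bar>)) \<partial>lborel)"
    using assms(1) by (intro product_nn_integral_prod) auto
  also have "\<dots> < \<infinity>"
    using nn_integral_exp_minus_abs_finite[OF assms(2)]
    by (simp add: power_less_top_ennreal)
  finally show ?thesis .
qed

text \<open>
  The unit cubes with lowest corner \<open>n v\<close> are pairwise disjoint because \<open>v\<close> moves by more than 1
  in coordinate \<open>k\<close>, and each has volume 1, so each contributes at least \<open>c\<close> to the integral.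
\<close>

lemma nn_integral_infinite_if_bounded_below_on_moving_cubes:
  fixes h :: "('k \<Rightarrow> real) \<Rightarrow> ennreal"
  assumes fin: "finite J" and k: "k \<in> J" "1 < \<bar>v k\<bar>" and c: "c > 0"
    and h: "\<And>n \<theta>. (\<And>i. i \<in> J \<Longrightarrow> real n * v i \<le> \<theta> i \<and> \<theta> i \<le> real n * v i + 1) \<Longrightarrow> c \<le> h \<theta>"
  shows "(\<integral>\<^sup>+ \<theta>. h \<theta> \<partial>Pi\<^sub>M J (\<lambda>_. lborel)) = \<infinity>"
proof -
  interpret product_sigma_finite "\<lambda>_::'k. lborel :: real measure"
    by unfold_locales
  let ?M = "Pi\<^sub>M J (\<lambda>_. lborel :: real measure)"
  define B where "B n = PiE J (\<lambda>i. {real n * v i..real n * v i + 1})" for n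
  have meas: "B n \<in> sets ?M" for n
    unfolding B_def using fin by (intro sets_PiM_I_finite) auto
  have one: "emeasure ?M (B n) = 1" for n
    unfolding B_def by (subst emeasure_PiM[OF fin]) auto
  have disj: "disjoint_family B"
  proof -
    have "m = n" if "\<theta> \<in> B m" "\<theta> \<in> B n" for m n \<theta>
    proof (rule ccontr)
      assume "m \<noteq> n"
      then have "1 \<le> \<bar>real m - real n\<bar>" by linarith
      then have "1 < \<bar>real m - real n\<bar> * \<bar>v k\<bar>"
        using k(2) mult_mono[of 1 "\<bar>real m - real n\<bar>" "\<bar>v k\<bar>" "\<bar>v k\<bar>"] by simp
      also have "\<dots> = \<bar>real m * v k - real n * v k\<bar>"
        by (simp add: abs_mult[symmetric] algebra_simps)
      also have "\<dots> \<le> 1"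
        using that k(1) by (force simp: B_def PiE_iff abs_le_iff)
      finally show False by simp
    qed
    then show ?thesis by (auto simp: disjoint_family_on_def)
  qed
  have "(\<Sum>n::nat. ennreal 1) = top"
    using summable_suminf_not_top[of "\<lambda>_. 1"] summable_const_iff[of "1::real"] by fastforce
  then have "\<infinity> = c * (\<Sum>n. emeasure ?M (B n))"
    using c by (simp add: one ennreal_mult_top)
  also have "\<dots> = c * emeasure ?M (\<Union>n. B n)"
    using meas disj by (subst suminf_emeasure) auto
  also have "\<dots> = (\<integral>\<^sup>+ \<theta>. c * indicator (\<Union>n. B n) \<theta> \<partial>?M)"
    using meas by (subst nn_integral_cmult_indicator) auto
  also have "\<dots> \<le> (\<integral>\<^sup>+ \<theta>. h \<theta> \<partial>?M)"
  proof (intro nn_integral_mono)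
    fix \<theta>
    show "c * indicator (\<Union>n. B n) \<theta> \<le> h \<theta>"
    proof (cases "\<theta> \<in> (\<Union>n. B n)")
      case True
      then obtain n where "\<theta> \<in> B n" by blast
      then have "c \<le> h \<theta>"
        by (intro h[of n]) (auto simp: B_def PiE_iff)
      with True show ?thesis by simp
    qed simp
  qed
  finally show ?thesis by (simp add: top.extremum_unique)
qed

section \<open>Conjugate priors of a minimal exponential family\<close>

text \<open>
  Identifiability says that no nonzero linear functional is constant on the vectors \<open>f j\<close>, that
  is, their affine hull is the whole coordinate space: the family is minimal.
\<close>

locale finite_exponential_family =
  fixes C :: "'c set" and J :: "'k set" and f :: "'c \<Rightarrow> 'k \<Rightarrow> real"
  assumes finite_C: "finite C" and C_nonempty: "C \<noteq> {}"
    and finite_J: "finite J" and J_nonempty: "J \<noteq> {}"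
    and identifiable: "\<And>u c. (\<And>j. j \<in> C \<Longrightarrow> pairing J (f j) u = c) \<Longrightarrow> \<forall>k\<in>J. u k = 0"
begin

definition Z :: "('k \<Rightarrow> real) \<Rightarrow> real" where
  "Z \<theta> = (\<Sum>j\<in>C. exp (pairing J (f j) \<theta>))"

definition mean :: "('k \<Rightarrow> real) \<Rightarrow> 'k \<Rightarrow> real" where
  "mean \<theta> k = (\<Sum>j\<in>C. f j k * (exp (pairing J (f j) \<theta>) / Z \<theta>))"

text \<open>The negative logarithm of the unnormalised conjugate prior density.\<close>

definition potential :: "('k \<Rightarrow> real) \<Rightarrow> real \<Rightarrow> ('k \<Rightarrow> real) \<Rightarrow> real" where
  "potential s \<alpha> \<theta> = \<alpha> * ln (Z \<theta>) - pairing J s \<theta>"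

text \<open>
  For \<open>\<alpha> > 0\<close> this is the separating-hyperplane form of: \<open>s / \<alpha>\<close> is an interior point of the
  convex hull of the vectors \<open>f j\<close>.
\<close>

definition strictly_inside :: "('k \<Rightarrow> real) \<Rightarrow> real \<Rightarrow> bool" where
  "strictly_inside s \<alpha> \<longleftrightarrow>
     (\<forall>u. (\<exists>k\<in>J. u k \<noteq> 0) \<longrightarrow> (\<exists>j\<in>C. pairing J s u < \<alpha> * pairing J (f j) u))"

lemma Z_pos: "Z \<theta> > 0"
  unfolding Z_def by (intro sum_pos finite_C C_nonempty) auto

lemma pairing_le_ln_Z: "j \<in> C \<Longrightarrow> pairing J (f j) \<theta> \<le> ln (Z \<theta>)"
  unfolding ln_ge_iff[OF Z_pos]
  unfolding Z_def by (rule member_le_sum) (auto simp: finite_C)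

lemma ln_Z_le:
  assumes "\<And>j. j \<in> C \<Longrightarrow> pairing J (f j) \<theta> \<le> a"
  shows "ln (Z \<theta>) \<le> ln (card C) + a"
proof -
  have "card C > 0"
    using finite_C C_nonempty by (simp add: card_gt_0_iff)
  have "Z \<theta> \<le> (\<Sum>j\<in>C. exp a)"
    unfolding Z_def using assms by (intro sum_mono) simp
  also have "\<dots> = exp (ln (card C) + a)"
    using \<open>card C > 0\<close> by (simp add: exp_add)
  finally show ?thesis
    by (metis Z_pos exp_gt_zero exp_ln ln_exp ln_le_cancel_iff)
qed

lemma potential_cong:
  "(\<And>k. k \<in> J \<Longrightarrow> \<theta> k = \<theta>' k) \<Longrightarrow> potential s \<alpha> \<theta> = potential s \<alpha> \<theta>'"
  unfolding potential_def Z_def by (simp cong: pairing_cong)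

lemma continuous_on_potential: "continuous_on S (potential s \<alpha>)"
  unfolding potential_def Z_def
  using Z_pos by (intro continuous_intros continuous_on_pairing) (auto simp: Z_def less_le)

text \<open>
  A mean is a convex combination of the vectors \<open>f j\<close> with all weights positive. A half-space
  that contains the convex hull and has such a point on its bounding hyperplane must have every
  \<open>f j\<close> on that hyperplane, which
  identifiability forbids.
\<close>

lemma mean_strictly_inside:
  assumes "\<alpha> > 0" and s: "\<And>k. k \<in> J \<Longrightarrow> s k = \<alpha> * mean \<theta> k"
  shows "strictly_inside s \<alpha>"
  unfolding strictly_inside_def
proof (intro allI impI, rule ccontr)
  fix u assume u: "\<exists>k\<in>J. u k \<noteq> 0" and "\<not> (\<exists>j\<in>C. pairing J s u < \<alpha> * pairing J (f j) u)"
  then have le: "\<And>j. j \<in> C \<Longrightarrow> \<alpha> * pairing J (f j) u \<le> pairing J s u"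
    by force
  define p where "p j = exp (pairing J (f j) \<theta>) / Z \<theta>" for j
  have p: "p j > 0" for j
    unfolding p_def using Z_pos by simp
  have p1: "(\<Sum>j\<in>C. p j) = 1"
    unfolding p_def using Z_pos[of \<theta>] by (simp add: Z_def flip: sum_divide_distrib)
  have "pairing J s u = (\<Sum>k\<in>J. \<Sum>j\<in>C. \<alpha> * p j * (u k * f j k))"
    unfolding pairing_def
    by (intro sum.cong) (simp_all add: s mean_def p_def sum_distrib_left mult_ac)
  also have "\<dots> = (\<Sum>j\<in>C. p j * (\<alpha> * pairing J (f j) u))"
    by (subst sum.swap) (simp add: pairing_def sum_distrib_left mult_ac)
  finally have "(\<Sum>j\<in>C. p j * (pairing J s u - \<alpha> * pairing J (f j) u)) = 0"
    by (simp add: right_diff_distrib sum_subtractf p1 flip: sum_distrib_right)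
  then have "\<forall>j\<in>C. p j * (pairing J s u - \<alpha> * pairing J (f j) u) = 0"
    using p le by (subst (asm) sum_nonneg_eq_0_iff) (auto simp: finite_C less_imp_le)
  then have "\<And>j. j \<in> C \<Longrightarrow> pairing J (f j) u = pairing J s u / \<alpha>"
    using p \<open>\<alpha> > 0\<close> by (auto simp: field_simps less_le)
  from identifiable[OF this] u show False by auto
qed

text \<open>
  The potential dominates \<open>\<alpha> * pairing J (f j) \<theta> - pairing J s \<theta>\<close> for every \<open>j\<close>. The
  maximum over \<open>j\<close> of these linear functions is positive on the compact unit sphere, hence bounded
  away from 0 there, and it is homogeneous of degree 1.
\<close>

lemma potential_coercive:
  assumes "\<alpha> > 0" and inside: "strictly_inside s \<alpha>"
  obtains c where "c > 0" "\<And>\<theta>. c * l1_norm J \<theta> \<le> potential s \<alpha> \<theta>"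
proof -
  define S where "S = cube J 1 \<inter> {\<theta>. l1_norm J \<theta> = 1}"
  \<comment> \<open>a sum of positive parts replaces the maximum over \<open>j\<close>: it is plainly continuous, and some
    summand is at least the average\<close>
  define gap where "gap \<theta> = (\<Sum>j\<in>C. max 0 (\<alpha> * pairing J (f j) \<theta> - pairing J s \<theta>))" for \<theta>
  have "closed {\<theta>::'k \<Rightarrow> real. l1_norm J \<theta> = 1}"
    using continuous_on_l1_norm by (intro closed_Collect_eq continuous_on_const) auto
  then have S: "compact S"
    unfolding S_def by (intro compact_Int_closed compact_cube)
  have cont: "continuous_on S gap"
    unfolding gap_def by (intro continuous_intros continuous_on_pairing)
  have gap_pos: "gap \<theta> > 0" if "\<theta> \<in> S" for \<theta>
  proof -
    have "\<exists>k\<in>J. \<theta> k \<noteq> 0"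
    proof (rule ccontr)
      assume "\<not> ?thesis"
      then have "l1_norm J \<theta> = 0" by (simp add: l1_norm_def)
      with that show False by (simp add: S_def)
    qed
    then obtain j where "j \<in> C" "pairing J s \<theta> < \<alpha> * pairing J (f j) \<theta>"
      using inside by (auto simp: strictly_inside_def)
    then show ?thesis
      unfolding gap_def by (intro sum_pos2[of _ j]) (auto simp: finite_C)
  qed
  obtain k0 where "k0 \<in> J" using J_nonempty by auto
  then have "(\<lambda>k. if k = k0 then 1 else 0) \<in> S"
    using finite_J by (auto simp: S_def cube_def l1_norm_def if_distrib cong: if_cong)
  then obtain \<eta> where \<eta>: "\<eta> \<in> S" "\<And>\<theta>. \<theta> \<in> S \<Longrightarrow> gap \<eta> \<le> gap \<theta>"
    using continuous_attains_inf[OF S _ cont] by blast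
  define c where "c = gap \<eta> / card C"
  have cC: "real (card C) > 0"
    using finite_C C_nonempty by (simp add: card_gt_0_iff)
  have "c > 0" unfolding c_def using gap_pos[OF \<eta>(1)] cC by simp
  have on_S: "\<exists>j\<in>C. c \<le> \<alpha> * pairing J (f j) \<theta> - pairing J s \<theta>" if "\<theta> \<in> S" for \<theta>
  proof (rule ccontr)
    assume "\<not> ?thesis"
    then have "gap \<theta> < (\<Sum>j\<in>C. c)"
      unfolding gap_def using \<open>c > 0\<close> by (intro sum_strict_mono finite_C C_nonempty) auto
    also have "\<dots> = gap \<eta>" unfolding c_def using cC by simp
    finally show False using \<eta>(2)[OF that] by simp
  qed
  have "c * l1_norm J \<theta> \<le> potential s \<alpha> \<theta>" for \<theta>
  proof -
    have "\<exists>j\<in>C. c * l1_norm J \<theta> \<le> \<alpha> * pairing J (f j) \<theta> - pairing J s \<theta>"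
    proof (cases "l1_norm J \<theta> = 0")
      case True
      then have "\<forall>k\<in>J. \<theta> k = 0"
        unfolding l1_norm_def by (subst (asm) sum_nonneg_eq_0_iff) (auto simp: finite_J)
      then show ?thesis
        using C_nonempty True by (auto simp: pairing_def)
    next
      case False
      define r where "r = l1_norm J \<theta>"
      have r: "r > 0"
        using False sum_nonneg[of J "\<lambda>k. \<bar>\<theta> k\<bar>"] by (simp add: r_def l1_norm_def less_le)
      \<comment> \<open>the coordinates outside \<open>J\<close> are cleared so that the rescaled point lies in the cube\<close>
      define \<theta>' where "\<theta>' = (\<lambda>k. (1 / r) * (if k \<in> J then \<theta> k else 0))"
      have p: "pairing J a \<theta> = r * pairing J a \<theta>'" for a
        unfolding \<theta>'_def pairing_scale using r by (simp cong: pairing_cong)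
      have "l1_norm J \<theta>' = 1"
        using r unfolding \<theta>'_def l1_norm_def
        by (simp add: abs_mult r_def[unfolded l1_norm_def] flip: sum_divide_distrib)
      moreover have "\<theta>' \<in> cube J 1"
        using coordinate_le_l1_norm[OF finite_J, of _ \<theta>'] \<open>l1_norm J \<theta>' = 1\<close>
        by (simp add: cube_def) (simp add: \<theta>'_def)
      ultimately obtain j where j: "j \<in> C" "c \<le> \<alpha> * pairing J (f j) \<theta>' - pairing J s \<theta>'"
        using on_S by (auto simp: S_def)
      have "r * c \<le> r * (\<alpha> * pairing J (f j) \<theta>' - pairing J s \<theta>')"
        using j(2) r by simp
      then have "c * r \<le> \<alpha> * pairing J (f j) \<theta> - pairing J s \<theta>"
        unfolding p by (simp add: algebra_simps)
      then show ?thesis using j(1) by (auto simp: r_def)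
    qed
    then obtain j where "j \<in> C" "c * l1_norm J \<theta> \<le> \<alpha> * pairing J (f j) \<theta> - pairing J s \<theta>"
      by blast
    moreover have "\<alpha> * pairing J (f j) \<theta> \<le> \<alpha> * ln (Z \<theta>)"
      using pairing_le_ln_Z[OF \<open>j \<in> C\<close>] \<open>\<alpha> > 0\<close> by simp
    ultimately show ?thesis
      unfolding potential_def by linarith
  qed
  with \<open>c > 0\<close> that show thesis by blast
qed

lemma strictly_inside_imp_finite_integral:
  assumes "\<alpha> > 0" "strictly_inside s \<alpha>"
  shows "(\<integral>\<^sup>+ \<theta>. ennreal (exp (- potential s \<alpha> \<theta>)) \<partial>Pi\<^sub>M J (\<lambda>_. lborel)) < \<infinity>"
proof -
  obtain c where c: "c > 0" "\<And>\<theta>. c * l1_norm J \<theta> \<le> potential s \<alpha> \<theta>"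
    using potential_coercive[OF assms] by blast
  have "(\<integral>\<^sup>+ \<theta>. ennreal (exp (- potential s \<alpha> \<theta>)) \<partial>Pi\<^sub>M J (\<lambda>_. lborel))
      \<le> (\<integral>\<^sup>+ \<theta>. ennreal (exp (- c * l1_norm J \<theta>)) \<partial>Pi\<^sub>M J (\<lambda>_. lborel))"
    using c(2) by (intro nn_integral_mono ennreal_leI) simp
  also have "\<dots> < \<infinity>"
    using nn_integral_exp_minus_l1_norm_finite[OF finite_J c(1)] .
  finally show ?thesis .
qed

text \<open>
  The gradient of \<open>ln Z\<close> is \<open>mean\<close>, so the vanishing of the partial derivative in
  coordinate \<open>k\<close> at a minimum is the claimed equation.
\<close>

lemma critical_point_mean:
  assumes min: "\<And>\<theta>. potential s \<alpha> \<eta> \<le> potential s \<alpha> \<theta>" and k: "k \<in> J"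
  shows "s k = \<alpha> * mean \<eta> k"
proof -
  \<comment> \<open>the potential restricted to the line through \<open>\<eta>\<close> in coordinate direction \<open>k\<close>\<close>
  define g where "g h = potential s \<alpha> (\<eta>(k := \<eta> k + h))" for h
  have g: "g h = \<alpha> * ln (\<Sum>j\<in>C. exp (pairing J (f j) \<eta> + h * f j k)) - (pairing J s \<eta> + h * s k)" for h
    unfolding g_def potential_def Z_def using finite_J k by (simp add: pairing_fun_upd)
  have "(g has_real_derivative
      \<alpha> * ((\<Sum>j\<in>C. exp (pairing J (f j) \<eta> + 0 * f j k) * f j k) /
            (\<Sum>j\<in>C. exp (pairing J (f j) \<eta> + 0 * f j k))) - s k) (at 0)"
    unfolding g using Z_pos[of \<eta>]
    by (auto intro!: derivative_eq_intros simp: Z_def)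
  moreover have "g 0 \<le> g h" for h
    using min by (simp add: g_def)
  ultimately have "\<alpha> * ((\<Sum>j\<in>C. exp (pairing J (f j) \<eta> + 0 * f j k) * f j k) /
            (\<Sum>j\<in>C. exp (pairing J (f j) \<eta> + 0 * f j k))) - s k = 0"
    by (intro DERIV_local_min[where d = 1 and f = g and x = 0]) auto
  then show ?thesis
    by (simp add: mean_def Z_def sum_divide_distrib mult.commute)
qed

text \<open>
  By coercivity the potential exceeds its value at 0 outside a large cube, so its minimum over the
  compact cube is global.
\<close>

lemma strictly_inside_imp_mean:
  assumes "\<alpha> > 0" "strictly_inside s \<alpha>"
  shows "\<exists>\<theta>. \<forall>k\<in>J. s k = \<alpha> * mean \<theta> k"
proof -
  obtain c where c: "c > 0" "\<And>\<theta>. c * l1_norm J \<theta> \<le> potential s \<alpha> \<theta>"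
    using potential_coercive[OF assms] by blast
  define m where "m = potential s \<alpha> (\<lambda>_. 0)"
  define R where "R = m / c"
  have "0 \<le> m"
    using c(2)[of "\<lambda>_. 0"] by (simp add: m_def l1_norm_def)
  then have "(\<lambda>_. 0) \<in> cube J R"
    using c(1) by (simp add: cube_def R_def)
  then obtain \<eta> where \<eta>: "\<eta> \<in> cube J R" "\<And>\<theta>. \<theta> \<in> cube J R \<Longrightarrow> potential s \<alpha> \<eta> \<le> potential s \<alpha> \<theta>"
    using continuous_attains_inf[OF compact_cube _ continuous_on_potential] by blast
  have "potential s \<alpha> \<eta> \<le> potential s \<alpha> \<theta>" for \<theta>
  proof (cases "\<forall>k\<in>J. \<bar>\<theta> k\<bar> \<le> R")
    case True
    then have "potential s \<alpha> \<eta> \<le> potential s \<alpha> (\<lambda>k. if k \<in> J then \<theta> k else 0)"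
      by (intro \<eta>(2) cube_projection) auto
    also have "\<dots> = potential s \<alpha> \<theta>"
      by (rule potential_cong) simp
    finally show ?thesis .
  next
    case False
    then have "R \<le> l1_norm J \<theta>"
      using coordinate_le_l1_norm[OF finite_J] by (meson linear order_trans)
    then have "m \<le> c * l1_norm J \<theta>"
      using c(1) by (simp add: R_def field_simps)
    also have "\<dots> \<le> potential s \<alpha> \<theta>" by (rule c(2))
    finally show ?thesis
      using \<eta>(2)[OF \<open>(\<lambda>_. 0) \<in> cube J R\<close>] by (simp add: m_def)
  qed
  then show ?thesis
    using critical_point_mean by blast
qed

text \<open>
  Since \<open>ln (Z \<theta>) \<ge> pairing J (f b) \<theta>\<close> for any \<open>b \<in> C\<close> and \<open>\<alpha> \<le> 0\<close>, the density is at
  least the exponential of the linear functional \<open>w = s - \<alpha> f b\<close>, which does not decrease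
  along a coordinate direction of suitable sign.
\<close>

lemma infinite_integral_if_nonpositive:
  assumes "\<alpha> \<le> 0"
  shows "(\<integral>\<^sup>+ \<theta>. ennreal (exp (- potential s \<alpha> \<theta>)) \<partial>Pi\<^sub>M J (\<lambda>_. lborel)) = \<infinity>"
proof -
  obtain b where b: "b \<in> C" using C_nonempty by auto
  obtain k where k: "k \<in> J" using J_nonempty by auto
  define w where "w = (\<lambda>i. s i - \<alpha> * f b i)"
  \<comment> \<open>length 2, so that consecutive translates of the unit cube are disjoint\<close>
  define v where "v = (\<lambda>i. if i = k then if w k \<ge> 0 then 2 else - 2 else 0 :: real)"
  have "pairing J w v = (\<Sum>i\<in>J. if i = k then 2 * \<bar>w k\<bar> else 0)"
    unfolding pairing_def v_def by (intro sum.cong) auto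
  then have v: "pairing J w v \<ge> 0"
    using finite_J k by simp
  have w: "pairing J w \<theta> \<le> - potential s \<alpha> \<theta>" for \<theta>
  proof -
    have "pairing J w \<theta> = pairing J s \<theta> - \<alpha> * pairing J (f b) \<theta>"
      by (simp add: pairing_def w_def algebra_simps sum_subtractf sum_distrib_left)
    moreover have "\<alpha> * ln (Z \<theta>) \<le> \<alpha> * pairing J (f b) \<theta>"
      using pairing_le_ln_Z[OF b] assms by (rule mult_left_mono_neg)
    ultimately show ?thesis by (simp add: potential_def)
  qed
  show ?thesis
  proof (rule nn_integral_infinite_if_bounded_below_on_moving_cubes[OF finite_J k,
        where v = v and c = "ennreal (exp (- (\<Sum>k\<in>J. \<bar>w k\<bar>)))"])
    fix n \<theta> assume \<theta>: "\<And>i. i \<in> J \<Longrightarrow> real n * v i \<le> \<theta> i \<and> \<theta> i \<le> real n * v i + 1"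
    define \<theta>' where "\<theta>' = (\<lambda>i. \<theta> i - real n * v i)"
    have "\<bar>pairing J w \<theta>'\<bar> \<le> (\<Sum>k\<in>J. \<bar>w k\<bar>)"
      using \<theta> by (intro abs_pairing_le_on_unit_cube) (force simp: \<theta>'_def)
    moreover have "pairing J w \<theta> = pairing J w \<theta>' + real n * pairing J w v"
      using pairing_add[of J w \<theta>' "\<lambda>i. real n * v i"] by (simp add: \<theta>'_def pairing_scale)
    moreover have "real n * pairing J w v \<ge> 0"
      using v by simp
    ultimately show "ennreal (exp (- (\<Sum>k\<in>J. \<bar>w k\<bar>))) \<le> ennreal (exp (- potential s \<alpha> \<theta>))"
      using w[of \<theta>] by (intro ennreal_leI) simp
  qed (auto simp: v_def)
qed

text \<open>
  Let \<open>u\<close> be a direction with \<open>\<alpha> * pairing J (f j) u \<le> pairing J s u\<close> for all \<open>j\<close>. Moving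
  by \<open>u\<close> raises \<open>\<alpha> ln Z\<close> by at most \<open>pairing J s u\<close>, which is what the linear term
  gains. So the potential stays bounded above on all translates of the unit cube along \<open>u\<close>.
\<close>

lemma infinite_integral_if_not_strictly_inside:
  assumes "\<alpha> > 0" "\<not> strictly_inside s \<alpha>"
  shows "(\<integral>\<^sup>+ \<theta>. ennreal (exp (- potential s \<alpha> \<theta>)) \<partial>Pi\<^sub>M J (\<lambda>_. lborel)) = \<infinity>"
proof -
  obtain u k where k: "k \<in> J" "u k \<noteq> 0"
    and u: "\<And>j. j \<in> C \<Longrightarrow> \<alpha> * pairing J (f j) u \<le> pairing J s u"
    using assms(2) by (force simp: strictly_inside_def)
  \<comment> \<open>rescaled so that \<open>\<bar>v k\<bar> = 2\<close> and consecutive translates of the unit cube are disjoint\<close>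
  define v where "v = (\<lambda>i. 2 / \<bar>u k\<bar> * u i)"
  have v: "\<alpha> * pairing J (f j) v \<le> pairing J s v" if "j \<in> C" for j
    using mult_left_mono[OF u[OF that], of "2 / \<bar>u k\<bar>"]
    unfolding v_def pairing_scale by (simp add: mult_ac)
  have vk: "1 < \<bar>v k\<bar>" using k by (simp add: v_def abs_mult)
  define a where "a = (\<Sum>j\<in>C. \<Sum>i\<in>J. \<bar>f j i\<bar>)"
  \<comment> \<open>an upper bound for the potential on every translated cube\<close>
  define r where "r = \<alpha> * ln (card C) + \<alpha> * a + (\<Sum>i\<in>J. \<bar>s i\<bar>)"
  show ?thesis
  proof (rule nn_integral_infinite_if_bounded_below_on_moving_cubes[where v = v
        and c = "ennreal (exp (- r))", OF finite_J k(1) vk])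
    fix n \<theta> assume \<theta>: "\<And>i. i \<in> J \<Longrightarrow> real n * v i \<le> \<theta> i \<and> \<theta> i \<le> real n * v i + 1"
    define \<theta>' where "\<theta>' = (\<lambda>i. \<theta> i - real n * v i)"
    have bound: "\<bar>pairing J b \<theta>'\<bar> \<le> (\<Sum>i\<in>J. \<bar>b i\<bar>)" for b
      using \<theta> by (intro abs_pairing_le_on_unit_cube) (force simp: \<theta>'_def)
    have split: "pairing J b \<theta> = pairing J b \<theta>' + real n * pairing J b v" for b
      using pairing_add[of J b \<theta>' "\<lambda>i. real n * v i"] by (simp add: \<theta>'_def pairing_scale)
    have "pairing J (f j) \<theta> \<le> a + real n * pairing J s v / \<alpha>" if j: "j \<in> C" for j
    proof -
      have "pairing J (f j) \<theta>' \<le> (\<Sum>i\<in>J. \<bar>f j i\<bar>)"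
        using bound[of "f j"] by linarith
      also have "\<dots> \<le> a"
        unfolding a_def using j finite_C by (intro member_le_sum) (auto intro: sum_nonneg)
      finally have "pairing J (f j) \<theta>' \<le> a" .
      moreover have "pairing J (f j) v \<le> pairing J s v / \<alpha>"
        using v[OF j] assms(1) by (simp add: field_simps)
      then have "real n * pairing J (f j) v \<le> real n * (pairing J s v / \<alpha>)"
        by (intro mult_left_mono) auto
      ultimately show ?thesis by (simp add: split)
    qed
    then have "ln (Z \<theta>) \<le> ln (card C) + (a + real n * pairing J s v / \<alpha>)"
      by (rule ln_Z_le)
    then have "\<alpha> * ln (Z \<theta>) \<le> \<alpha> * (ln (card C) + (a + real n * pairing J s v / \<alpha>))"
      using assms(1) by simp
    also have "\<dots> = \<alpha> * ln (card C) + \<alpha> * a + real n * pairing J s v"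
      using assms(1) by (simp add: field_simps)
    finally have "potential s \<alpha> \<theta> \<le> r"
      using bound[of s] by (simp add: potential_def split r_def)
    then show "ennreal (exp (- r)) \<le> ennreal (exp (- potential s \<alpha> \<theta>))"
      by (intro ennreal_leI) simp
  qed auto
qed

theorem conjugate_prior_proper_iff:
  "(\<integral>\<^sup>+ \<theta>. ennreal (exp (- potential s \<alpha> \<theta>)) \<partial>Pi\<^sub>M J (\<lambda>_. lborel)) < \<infinity> \<longleftrightarrow>
     \<alpha> > 0 \<and> (\<exists>\<theta>. \<forall>k\<in>J. s k = \<alpha> * mean \<theta> k)"
proof (cases "\<alpha> > 0")
  case True
  then show ?thesis
    using strictly_inside_imp_finite_integral infinite_integral_if_not_strictly_inside[OF True, of s]
      mean_strictly_inside[OF True] strictly_inside_imp_mean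
    by (metis order_less_irrefl)
next
  case False
  then show ?thesis
    using infinite_integral_if_nonpositive[of \<alpha> s] by simp
qed

end

section \<open>Hierarchical log-linear models\<close>

text \<open>
  The vector \<open>f\<^sub>j\<close> of the cell \<open>j\<close>: the indicator of the marginal cells that \<open>j\<close> belongs to.
\<close>

definition cell_statistic :: "('v \<Rightarrow> 'l) \<Rightarrow> 'v set \<times> ('v \<Rightarrow> 'l) \<Rightarrow> real" where
  "cell_statistic j = (\<lambda>(D, x). of_bool (restrict j D = x))"

locale hierarchical_model =
  fixes V :: "'v set" and L :: "'v \<Rightarrow> 'l set" and z :: "'v \<Rightarrow> 'l" and \<D> :: "'v set set"
  assumes finite_V: "finite V"
    and finite_levels: "\<And>\<gamma>. \<gamma> \<in> V \<Longrightarrow> finite (L \<gamma>)"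
    and two_levels: "\<And>\<gamma>. \<gamma> \<in> V \<Longrightarrow> 2 \<le> card (L \<gamma>)"
    and zero_level: "\<And>\<gamma>. \<gamma> \<in> V \<Longrightarrow> z \<gamma> \<in> L \<gamma>"
    and model_subset: "\<And>D. D \<in> \<D> \<Longrightarrow> D \<subseteq> V"
    and model_nonempty: "\<D> \<noteq> {}"
    and model_proper: "{} \<notin> \<D>"
begin

lemma finite_model: "finite \<D>"
  using model_subset finite_V by (meson PowI finite_Pow_iff finite_subset subsetI)

lemma finite_cells: "E \<subseteq> V \<Longrightarrow> finite (cells L E)"
  unfolding cells_def using finite_V finite_levels by (intro finite_PiE) (auto intro: finite_subset)

lemma finite_nonzero_cells: "E \<subseteq> V \<Longrightarrow> finite (nonzero_cells L z E)"
  unfolding nonzero_cells_def using finite_cells by auto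

lemma nonzero_cells_nonempty:
  assumes "E \<subseteq> V"
  shows "nonzero_cells L z E \<noteq> {}"
proof -
  have "\<exists>l\<in>L \<gamma>. l \<noteq> z \<gamma>" if "\<gamma> \<in> E" for \<gamma>
  proof (rule ccontr)
    assume "\<not> ?thesis"
    then have "L \<gamma> \<subseteq> {z \<gamma>}" by auto
    then have "card (L \<gamma>) \<le> 1" using card_mono[of "{z \<gamma>}"] by auto
    with two_levels[of \<gamma>] that assms show False by auto
  qed
  then have "\<forall>\<gamma>\<in>E. \<exists>l. l \<in> L \<gamma> \<and> l \<noteq> z \<gamma>" by blast
  then obtain x where "\<forall>\<gamma>\<in>E. x \<gamma> \<in> L \<gamma> \<and> x \<gamma> \<noteq> z \<gamma>"
    by (metis (no_types) bchoice)
  then have "restrict x E \<in> nonzero_cells L z E"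
    by (auto simp: nonzero_cells_def cells_def)
  then show ?thesis by blast
qed

text \<open>
  The inverse sends a cell to its support, the set of factors at nonzero level, and to its
  restriction to the support.
\<close>

lemma bij_betw_extend_cell:
  "bij_betw (\<lambda>(E, x). extend_cell V z E x) (Sigma (Pow V) (nonzero_cells L z)) (cells L V)"
proof (rule bij_betw_byWitness[where f' = "\<lambda>j. ({\<gamma>\<in>V. j \<gamma> \<noteq> z \<gamma>}, restrict j {\<gamma>\<in>V. j \<gamma> \<noteq> z \<gamma>})"])
  show "\<forall>p\<in>Sigma (Pow V) (nonzero_cells L z).
      (\<lambda>j. ({\<gamma>\<in>V. j \<gamma> \<noteq> z \<gamma>}, restrict j {\<gamma>\<in>V. j \<gamma> \<noteq> z \<gamma>})) ((\<lambda>(E, x). extend_cell V z E x) p) = p"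
  proof clarify
    fix E x assume E: "E \<subseteq> V" and x: "x \<in> nonzero_cells L z E"
    have supp: "{\<gamma>\<in>V. extend_cell V z E x \<gamma> \<noteq> z \<gamma>} = E"
      using E x by (auto simp: extend_cell_def nonzero_cells_def)
    have "restrict (extend_cell V z E x) E = x"
      using E x by (auto simp: extend_cell_def nonzero_cells_def cells_def PiE_iff extensional_def fun_eq_iff)
    with supp show "{\<gamma>\<in>V. extend_cell V z E x \<gamma> \<noteq> z \<gamma>} = E \<and>
        restrict (extend_cell V z E x) {\<gamma>\<in>V. extend_cell V z E x \<gamma> \<noteq> z \<gamma>} = x" by simp
  qed
  show "\<forall>j\<in>cells L V. (\<lambda>(E, x). extend_cell V z E x)
      ({\<gamma>\<in>V. j \<gamma> \<noteq> z \<gamma>}, restrict j {\<gamma>\<in>V. j \<gamma> \<noteq> z \<gamma>}) = j"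
    by (auto simp: extend_cell_def cells_def PiE_iff extensional_def fun_eq_iff)
  show "(\<lambda>(E, x). extend_cell V z E x) ` Sigma (Pow V) (nonzero_cells L z) \<subseteq> cells L V"
    using zero_level by (auto simp: extend_cell_def nonzero_cells_def cells_def)
  show "(\<lambda>j. ({\<gamma>\<in>V. j \<gamma> \<noteq> z \<gamma>}, restrict j {\<gamma>\<in>V. j \<gamma> \<noteq> z \<gamma>})) ` cells L V
      \<subseteq> Sigma (Pow V) (nonzero_cells L z)"
    by (auto simp: nonzero_cells_def cells_def)
qed

text \<open>
  The cell \<open>i(E)\<close> vanishes exactly off \<open>E\<close>, so its margin over \<open>F\<close> has all entries nonzero
  iff \<open>F \<subseteq> E\<close>, and then it is the margin \<open>i\<^sub>F\<close> of \<open>i\<^sub>E\<close>.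
\<close>

lemma theta_sum_eq_pairing:
  assumes "E \<subseteq> V" "x \<in> nonzero_cells L z E"
  shows "theta_sum \<D> \<theta> E x = pairing (param_index L z \<D>) (cell_statistic (extend_cell V z E x)) \<theta>"
proof -
  let ?j = "extend_cell V z E x"
  have inner: "(\<Sum>y\<in>nonzero_cells L z F. \<theta> (F, y) * cell_statistic ?j (F, y)) =
      (if F \<subseteq> E then \<theta> (F, restrict x F) else 0)" if "F \<in> \<D>" for F
  proof -
    have F: "F \<subseteq> V" using model_subset that .
    have "(\<Sum>y\<in>nonzero_cells L z F. \<theta> (F, y) * cell_statistic ?j (F, y)) =
      (\<Sum>y\<in>nonzero_cells L z F. if y = restrict ?j F then \<theta> (F, restrict ?j F) else 0)"
      by (intro sum.cong) (auto simp: cell_statistic_def)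
    also have "\<dots> = (if restrict ?j F \<in> nonzero_cells L z F then \<theta> (F, restrict ?j F) else 0)"
      using finite_nonzero_cells[OF F] by simp
    also have "restrict ?j F \<in> nonzero_cells L z F \<longleftrightarrow> F \<subseteq> E"
      using assms F zero_level by (force simp: extend_cell_def nonzero_cells_def cells_def subset_iff)
    also have "(if F \<subseteq> E then \<theta> (F, restrict ?j F) else 0) = (if F \<subseteq> E then \<theta> (F, restrict x F) else 0)"
    proof -
      have "restrict ?j F = restrict x F" if "F \<subseteq> E"
        using that F by (auto simp: extend_cell_def fun_eq_iff restrict_def)
      then show ?thesis by simp
    qed
    finally show ?thesis .
  qed
  have "pairing (param_index L z \<D>) (cell_statistic ?j) \<theta> =
      (\<Sum>F\<in>\<D>. \<Sum>y\<in>nonzero_cells L z F. \<theta> (F, y) * cell_statistic ?j (F, y))"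
    unfolding pairing_def param_index_def
    using finite_model finite_nonzero_cells model_subset by (subst sum.Sigma) (auto simp: case_prod_unfold)
  also have "\<dots> = (\<Sum>F\<in>\<D>. if F \<subseteq> E then \<theta> (F, restrict x F) else 0)"
    using inner by (intro sum.cong) auto
  also have "\<dots> = theta_sum \<D> \<theta> E x"
    unfolding theta_sum_def using finite_model by (simp add: sum.inter_filter)
  finally show ?thesis by simp
qed

lemma theta_sum_empty: "theta_sum \<D> \<theta> {} x = 0"
proof -
  have eq: "{F. F \<in> \<D> \<and> F \<subseteq> {}} = {}"
    using model_proper by auto
  show ?thesis unfolding theta_sum_def eq by simp
qed

text \<open>
  The constant is 0, the value at the cell \<open>i\<^sup>*\<close>. At \<open>i(D)\<close> the value is \<open>u(i\<^sub>D)\<close> plus the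
  terms \<open>u(i\<^sub>F)\<close> for smaller \<open>F\<close>, which vanish by induction on the size of \<open>D\<close>. This is
  where Moebius inversion would recover \<open>\<theta>\<close> from the log-linear cell values.
\<close>

lemma statistics_identifiable:
  assumes const: "\<And>j. j \<in> cells L V \<Longrightarrow> pairing (param_index L z \<D>) (cell_statistic j) u = c"
  shows "\<forall>k\<in>param_index L z \<D>. u k = 0"
proof -
  have theta: "theta_sum \<D> u E x = c" if "E \<subseteq> V" "x \<in> nonzero_cells L z E" for E x
    using theta_sum_eq_pairing[OF that] const bij_betw_apply[OF bij_betw_extend_cell, of "(E, x)"] that
    by simp
  obtain x0 where "x0 \<in> nonzero_cells L z {}" using nonzero_cells_nonempty[of "{}"] by auto
  then have "c = 0" using theta[of "{}" x0] by (simp add: theta_sum_empty)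
  have "D \<in> \<D> \<Longrightarrow> x \<in> nonzero_cells L z D \<Longrightarrow> u (D, x) = 0" for D x
  proof (induction "card D" arbitrary: D x rule: less_induct)
    case less
    have D: "D \<subseteq> V" using model_subset less.prems(1) .
    have "u (F, restrict x F) = 0" if "F \<in> \<D>" "F \<subset> D" for F
    proof (rule less.hyps[OF _ that(1)])
      show "card F < card D"
        using that(2) D finite_V by (intro psubset_card_mono) (auto intro: finite_subset)
      show "restrict x F \<in> nonzero_cells L z F"
        using less.prems(2) that(2) by (auto simp: nonzero_cells_def cells_def)
    qed
    then have "theta_sum \<D> u D x = (\<Sum>F | F \<in> \<D> \<and> F \<subseteq> D. if F = D then u (D, restrict x D) else 0)"
      unfolding theta_sum_def by (intro sum.cong) auto
    also have "\<dots> = u (D, restrict x D)"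
      using finite_model less.prems(1) by simp
    also have "restrict x D = x"
      using less.prems(2) by (auto simp: nonzero_cells_def cells_def)
    finally show ?case using theta[OF D less.prems(2)] \<open>c = 0\<close> by simp
  qed
  then show ?thesis by (auto simp: param_index_def)
qed

sublocale finite_exponential_family "cells L V" "param_index L z \<D>" cell_statistic
proof
  show "finite (cells L V)" by (simp add: finite_cells)
  show "cells L V \<noteq> {}"
    using zero_level by (auto simp: cells_def PiE_eq_empty_iff)
  show "finite (param_index L z \<D>)"
    unfolding param_index_def using finite_model finite_nonzero_cells model_subset by auto
  show "param_index L z \<D> \<noteq> {}"
  proof -
    obtain D where D: "D \<in> \<D>" using model_nonempty by auto
    then obtain x where "x \<in> nonzero_cells L z D"
      using nonzero_cells_nonempty[OF model_subset] by blast
    with D show ?thesis by (auto simp: param_index_def)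
  qed
qed (rule statistics_identifiable)

lemma partition_sum_eq_Z: "partition_sum V L z \<D> \<theta> = Z \<theta>"
proof -
  let ?g = "\<lambda>E. \<Sum>x\<in>nonzero_cells L z E. exp (theta_sum \<D> \<theta> E x)"
  have "Z \<theta> = (\<Sum>(E, x)\<in>Sigma (Pow V) (nonzero_cells L z).
      exp (pairing (param_index L z \<D>) (cell_statistic (extend_cell V z E x)) \<theta>))"
    unfolding Z_def
    by (subst sum.reindex_bij_betw[OF bij_betw_extend_cell, symmetric]) (simp add: case_prod_unfold)
  also have "\<dots> = (\<Sum>(E, x)\<in>Sigma (Pow V) (nonzero_cells L z). exp (theta_sum \<D> \<theta> E x))"
    by (intro sum.cong) (auto simp: theta_sum_eq_pairing)
  also have "\<dots> = (\<Sum>E\<in>Pow V. ?g E)"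
    using finite_V finite_nonzero_cells by (subst sum.Sigma) auto
  also have "\<dots> = ?g {} + (\<Sum>E\<in>Pow V - {{}}. ?g E)"
    using finite_V by (subst sum.remove[of _ "{}"]) auto
  also have "Pow V - {{}} = {E. E \<subseteq> V \<and> E \<noteq> {}}"
    by auto
  also have "?g {} = 1"
  proof -
    have "nonzero_cells L z {} = {\<lambda>_. undefined}"
      by (auto simp: nonzero_cells_def cells_def)
    then show ?thesis by (simp add: theta_sum_empty)
  qed
  finally show ?thesis by (simp add: partition_sum_def)
qed

lemma prior_kernel_eq: "prior_kernel V L z \<D> s \<alpha> \<theta> = exp (- potential s \<alpha> \<theta>)"
proof -
  have "pairing (param_index L z \<D>) s \<theta> = (\<Sum>D\<in>\<D>. \<Sum>x\<in>nonzero_cells L z D. \<theta> (D, x) * s (D, x))"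
    unfolding pairing_def param_index_def
    using finite_model finite_nonzero_cells model_subset by (subst sum.Sigma) (auto simp: case_prod_unfold)
  then show ?thesis
    by (simp add: prior_kernel_def potential_def partition_sum_eq_Z)
qed

text \<open>
  Every cell is \<open>i(E)\<close> for some \<open>E\<close> and \<open>i\<^sub>E\<close>, so prescribing \<open>\<rho>\<close> on the cells \<open>i(E)\<close> by the
  log-linear formula determines \<open>\<rho>\<close> on all cells as a member of the exponential family.
\<close>

lemma cell_probability_iff:
  fixes \<rho> :: "('v \<Rightarrow> 'l) \<Rightarrow> real" and \<theta> :: "('v, 'l) param"
  shows "(\<forall>E\<subseteq>V. \<forall>x\<in>nonzero_cells L z E.
      \<rho> (extend_cell V z E x) = exp (theta_sum \<D> \<theta> E x) / partition_sum V L z \<D> \<theta>) \<longleftrightarrow>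
   (\<forall>j\<in>cells L V. \<rho> j = exp (pairing (param_index L z \<D>) (cell_statistic j) \<theta>) / Z \<theta>)"
  (is "?l \<longleftrightarrow> ?r")
proof
  assume l: ?l
  show ?r
  proof
    fix j assume "j \<in> cells L V"
    then have "j \<in> (\<lambda>(E, x). extend_cell V z E x) ` Sigma (Pow V) (nonzero_cells L z)"
      by (simp only: bij_betw_imp_surj_on[OF bij_betw_extend_cell])
    then obtain E x where E: "E \<subseteq> V" "x \<in> nonzero_cells L z E" and j: "j = extend_cell V z E x"
      by auto
    have "\<rho> j = exp (theta_sum \<D> \<theta> E x) / partition_sum V L z \<D> \<theta>"
      using l E by (simp only: j)
    then show "\<rho> j = exp (pairing (param_index L z \<D>) (cell_statistic j) \<theta>) / Z \<theta>"
      by (simp only: theta_sum_eq_pairing[OF E] partition_sum_eq_Z j)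
  qed
next
  assume r: ?r
  show ?l
  proof (intro allI impI ballI)
    fix E x assume E: "E \<subseteq> V" "x \<in> nonzero_cells L z E"
    then have "extend_cell V z E x \<in> cells L V"
      using bij_betw_apply[OF bij_betw_extend_cell, of "(E, x)"] by simp
    with r show "\<rho> (extend_cell V z E x) = exp (theta_sum \<D> \<theta> E x) / partition_sum V L z \<D> \<theta>"
      by (simp only: theta_sum_eq_pairing[OF E] partition_sum_eq_Z)
  qed
qed

lemma mean_eq_marginal:
  fixes \<rho> :: "('v \<Rightarrow> 'l) \<Rightarrow> real"
  assumes "\<And>j. j \<in> cells L V \<Longrightarrow>
    \<rho> j = exp (pairing (param_index L z \<D>) (cell_statistic j) \<theta>) / Z \<theta>"
  shows "mean \<theta> (D, x) = (\<Sum>j | j \<in> cells L V \<and> restrict j D = x. \<rho> j)"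
proof -
  have "mean \<theta> (D, x) = (\<Sum>j\<in>cells L V. if restrict j D = x then \<rho> j else 0)"
    unfolding mean_def using assms by (intro sum.cong) (auto simp: cell_statistic_def)
  then show ?thesis
    by (simp add: finite_cells sum.inter_filter)
qed

end

theorem lemma3p1:
  fixes V :: "'v set" and L :: "'v \<Rightarrow> 'l set" and z :: "'v \<Rightarrow> 'l"
    and \<A> \<D> :: "'v set set" and s :: "('v, 'l) param" and \<alpha> :: real
  assumes "finite V" and "V \<noteq> {}"
    and "\<And>\<gamma>. \<gamma> \<in> V \<Longrightarrow> finite (L \<gamma>)"
    and "\<And>\<gamma>. \<gamma> \<in> V \<Longrightarrow> 2 \<le> card (L \<gamma>)"
    and "\<And>\<gamma>. \<gamma> \<in> V \<Longrightarrow> z \<gamma> \<in> L \<gamma>"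
    and "\<And>A. A \<in> \<A> \<Longrightarrow> A \<subseteq> V"
    and "\<D> = model_sets \<A>" and "\<D> \<noteq> {}"
  shows "prior_const V L z \<D> s \<alpha> < \<infinity> \<longleftrightarrow>
    \<alpha> > 0 \<and>
    (\<exists>\<rho> :: ('v \<Rightarrow> 'l) \<Rightarrow> real.
       (\<forall>j\<in>cells L V. \<rho> j > 0) \<and>
       (\<forall>D\<in>\<D>. \<forall>x\<in>nonzero_cells L z D.
          s (D, x) = \<alpha> * (\<Sum>j | j \<in> cells L V \<and> restrict j D = x. \<rho> j)) \<and>
       (\<exists>\<theta> :: ('v, 'l) param. \<forall>E\<subseteq>V. \<forall>x\<in>nonzero_cells L z E.
          \<rho> (extend_cell V z E x) =
            exp (theta_sum \<D> \<theta> E x) / partition_sum V L z \<D> \<theta>))"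
proof -
  have proper: "{} \<notin> \<D>" and subset: "\<And>D. D \<in> \<D> \<Longrightarrow> D \<subseteq> V"
    using assms(6) by (auto simp: \<open>\<D> = model_sets \<A>\<close> model_sets_def)
  interpret hierarchical_model V L z \<D>
    using assms proper subset by unfold_locales auto
  have "prior_const V L z \<D> s \<alpha> < \<infinity> \<longleftrightarrow>
      \<alpha> > 0 \<and> (\<exists>\<theta>. \<forall>D\<in>\<D>. \<forall>x\<in>nonzero_cells L z D. s (D, x) = \<alpha> * mean \<theta> (D, x))"
    unfolding prior_const_def param_lebesgue_def prior_kernel_eq conjugate_prior_proper_iff
    by (simp add: param_index_def)
  also have "(\<exists>\<theta>. \<forall>D\<in>\<D>. \<forall>x\<in>nonzero_cells L z D. s (D, x) = \<alpha> * mean \<theta> (D, x)) \<longleftrightarrow>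
      (\<exists>\<rho> :: ('v \<Rightarrow> 'l) \<Rightarrow> real.
       (\<forall>j\<in>cells L V. \<rho> j > 0) \<and>
       (\<forall>D\<in>\<D>. \<forall>x\<in>nonzero_cells L z D.
          s (D, x) = \<alpha> * (\<Sum>j | j \<in> cells L V \<and> restrict j D = x. \<rho> j)) \<and>
       (\<exists>\<theta>. \<forall>j\<in>cells L V. \<rho> j = exp (pairing (param_index L z \<D>) (cell_statistic j) \<theta>) / Z \<theta>))"
    (is "?mean \<longleftrightarrow> ?prob")
  proof
    assume ?mean
    then obtain \<theta> where \<theta>: "\<forall>D\<in>\<D>. \<forall>x\<in>nonzero_cells L z D. s (D, x) = \<alpha> * mean \<theta> (D, x)"
      by blast
    define \<rho> where "\<rho> j = exp (pairing (param_index L z \<D>) (cell_statistic j) \<theta>) / Z \<theta>" for j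
    show ?prob
      using \<theta> mean_eq_marginal[of \<rho> \<theta>] Z_pos by (intro exI[of _ \<rho>]) (auto simp: \<rho>_def)
  next
    assume ?prob
    then obtain \<rho> \<theta> where
      "\<forall>D\<in>\<D>. \<forall>x\<in>nonzero_cells L z D. s (D, x) = \<alpha> * (\<Sum>j | j \<in> cells L V \<and> restrict j D = x. \<rho> j)"
      "\<forall>j\<in>cells L V. \<rho> j = exp (pairing (param_index L z \<D>) (cell_statistic j) \<theta>) / Z \<theta>"
      by blast
    then show ?mean
      using mean_eq_marginal[of \<rho> \<theta>] by (intro exI[of _ \<theta>]) auto
  qed
  finally show ?thesis
    by (simp only: cell_probability_iff)
qed

end
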